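(* For every set composition $\Phi$, \[ \rho(P_\Phi)=\sum_{\rho_I(\Phi)\le\alpha\le\rho_C(\Phi)}\mu(\alpha,\rho_C(\Phi))\,F_\alpha , \] where $\le$ is refinement order on compositions and $\mu$ is its Möbius function. Equivalently, $\mu(\alpha,\beta)=(-1)^{\ell(\alpha)-\ell(\beta)}$ for $\alpha\le\beta$, where $\ell$ denotes number of parts.
   Context: Set compositions and the basis $M_\Phi$: a set composition $\Phi=B_1|\cdots|B_k$ of $n$ is a sequence of disjoint nonempty sets with union $[n]$. $x_1,x_2,\ldots$ are non-commuting variables and $x_w=x_{w_1}\cdots x_{w_n}$. For a word $w$ with distinct values $v_1<\dots<v_k$, $\varrho(w)=B_1|\cdots|B_k$ with $B_r=\{i:w_i=v_r\}$, and $M_\Phi=\sum_{\varrho(w)=\Phi}x_w$. The power sums $P_\Phi$: order blocks by $A>_{\mathcal D}B$ if $|A|>|B|$, or $|A|=|B|$ and $\min A<\min B$ (a total order on disjoint nonempty sets). $\mathsf{LDD}(\Phi)$ is the set of placements of $B_i$ in row $i$ of a matrix such that the following hold. - $B_1$ is in column 1. - $B_{i+1}$ is in the same column as $B_i$ or the next column if $B_i>_{\mathcal D}B_{i+1}$, and in the next column otherwise. $\mathsf{col}$ lists, left to right, the unions of the nonempty columns. Then $P_\Phi=\sum_{\tilde{\mathsf F}\in\mathsf{LDD}(\Phi)}M_{\mathsf{col}(\tilde{\mathsf F})}$. Projection and QSym: $\rho(\Phi)=(|B_1|,\dots,|B_k|)$, and $\rho$ is extended linearly by $\rho(M_\Phi)=M_{\rho(\Phi)}$.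 Here $M_\gamma=\sum_{i_1<\dots<i_k}x_{i_1}^{c_1}\cdots x_{i_k}^{c_k}$ is the quasisymmetric monomial function in commuting variables. Refinement order: $\alpha\le\beta$ if $\beta$ is obtained from $\alpha$ by adding consecutive parts. The fundamental quasisymmetric function is $F_\beta=\sum_{\alpha\le\beta}M_\alpha$. The compositions $\rho_C$ and $\rho_I$: cut the sequence $\rho(\Phi)=(|B_1|,\dots,|B_k|)$ between positions $i$ and $i+1$ exactly when $B_i<_{\mathcal D}B_{i+1}$. This writes $\rho(\Phi)=\alpha_1|\cdots|\alpha_l$ as a concatenation of segments, where within each segment consecutive blocks decrease in $>_{\mathcal D}$. - $\rho_C(\Phi)=(|\alpha_1|,\dots,|\alpha_l|)$, where $|\alpha_i|$ is the sum of the parts of $\alpha_i$. - $\rho_I(\Phi)=\alpha_1'|\cdots|\alpha_l'$, where for a composition $\gamma$ of $m$, $\gamma'$ is the composition of $m$ whose set of partial sums in $[m-1]$ is the complement of that of $\gamma$. For example, $\rho_C(2|5|14|36|7)=(2,5)$ and $\rho_I(2|5|14|36|7)=(2,1,2,2)$. *)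

theory Defs
  imports
    Complex_Main
    "HOL-Library.Disjoint_Sets"
    "HOL-Library.Function_Algebras"
    "HOL-Library.Poly_Mapping"
begin

section \<open>Formal power series\<close>

text \<open>
  A series over a set of monomials is the function giving its coefficients.  Series in the
  non-commuting variables \<open>x\<^sub>1, x\<^sub>2, \<dots>\<close> have type \<open>nat list \<Rightarrow> 'a\<close>, the word \<open>w\<close> standing for
  \<open>x\<^sub>w\<close>; series in the commuting variables have type \<open>(nat \<Rightarrow>\<^sub>0 nat) \<Rightarrow> 'a\<close>, the monomial being
  given by its exponents.  There is no variable \<open>x\<^sub>0\<close>.  Only addition and scalar multiplication
  of series are used; the pointwise product on functions is not the product of series.
\<close>

type_synonym 'a ncseries = "nat list \<Rightarrow> 'a"
type_synonym 'a cseries = "(nat \<Rightarrow>\<^sub>0 nat) \<Rightarrow> 'a"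

definition scl :: "'a::field \<Rightarrow> ('m \<Rightarrow> 'a) \<Rightarrow> 'm \<Rightarrow> 'a" where
  "scl c f = (\<lambda>m. c * f m)"

lemma vector_space_scl: "vector_space (scl :: 'a::field \<Rightarrow> ('m \<Rightarrow> 'a) \<Rightarrow> 'm \<Rightarrow> 'a)"
  by unfold_locales (auto simp: scl_def fun_eq_iff algebra_simps)


section \<open>Set compositions and the basis \<open>M\<^sub>\<Phi>\<close>\<close>

definition set_composition :: "nat \<Rightarrow> nat set list \<Rightarrow> bool" where
  "set_composition n \<Phi> \<longleftrightarrow> distinct \<Phi> \<and> partition_on {1..n} (set \<Phi>)"

definition word_blocks :: "nat list \<Rightarrow> nat set list" where
  "word_blocks w =
     map (\<lambda>v. {i \<in> {1..length w}. w ! (i - 1) = v}) (sorted_list_of_set (set w))"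

definition ncM :: "nat set list \<Rightarrow> 'a::field ncseries" where
  "ncM \<Phi> = (\<lambda>w. of_bool (0 \<notin> set w \<and> word_blocks w = \<Phi>))"


section \<open>The power sums \<open>P\<^sub>\<Phi>\<close>\<close>

definition gtD :: "nat set \<Rightarrow> nat set \<Rightarrow> bool" (infix \<open>>\<^sub>D\<close> 50) where
  "A >\<^sub>D B \<longleftrightarrow> card A > card B \<or> card A = card B \<and> Min A < Min B"

text \<open>A placement is recorded by the list of columns: \<open>B\<^sub>i\<close> is in row \<open>i\<close> and column \<open>c\<^sub>i\<close>.\<close>

definition LDD :: "nat set list \<Rightarrow> nat list set" where
  "LDD \<Phi> = {c. length c = length \<Phi> \<and> (\<Phi> \<noteq> [] \<longrightarrow> c ! 0 = 1) \<and>
     (\<forall>i. Suc i < length \<Phi> \<longrightarrow>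
        (if \<Phi> ! i >\<^sub>D \<Phi> ! Suc i then c ! Suc i = c ! i \<or> c ! Suc i = c ! i + 1
         else c ! Suc i = c ! i + 1))}"

definition col :: "nat set list \<Rightarrow> nat list \<Rightarrow> nat set list" where
  "col \<Phi> c = map (\<lambda>j. \<Union>{\<Phi> ! i | i. i < length \<Phi> \<and> c ! i = j}) (sorted_list_of_set (set c))"

definition ncP :: "nat set list \<Rightarrow> 'a::field ncseries" where
  "ncP \<Phi> = (\<Sum>c\<in>LDD \<Phi>. ncM (col \<Phi> c))"


section \<open>Compositions, refinement and its Moebius function\<close>

definition composition :: "nat list \<Rightarrow> bool" where
  "composition \<alpha> \<longleftrightarrow> 0 \<notin> set \<alpha>"

definition comp_le :: "nat list \<Rightarrow> nat list \<Rightarrow> bool" where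
  "comp_le \<alpha> \<beta> \<longleftrightarrow> (\<exists>\<alpha>s. concat \<alpha>s = \<alpha> \<and> [] \<notin> set \<alpha>s \<and> map sum_list \<alpha>s = \<beta>)"

lemma comp_le_length:
  assumes "comp_le \<alpha> \<beta>"
  shows "length \<beta> \<le> length \<alpha>" "length \<beta> = length \<alpha> \<Longrightarrow> \<alpha> = \<beta>"
proof -
  have *: "length \<alpha>s \<le> length (concat \<alpha>s) \<and>
        (length \<alpha>s = length (concat \<alpha>s) \<longrightarrow> concat \<alpha>s = map sum_list \<alpha>s)"
    if "[] \<notin> set \<alpha>s" for \<alpha>s :: "nat list list"
    using that
  proof (induction \<alpha>s)
    case (Cons a \<alpha>s)
    then have IH: "length \<alpha>s \<le> length (concat \<alpha>s)"
      "length \<alpha>s = length (concat \<alpha>s) \<Longrightarrow> concat \<alpha>s = map sum_list \<alpha>s" by simp_all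
    obtain x xs where a: "a = x # xs" using Cons.prems by (cases a) auto
    have le: "length (a # \<alpha>s) \<le> length (concat (a # \<alpha>s))" using IH(1) a by simp
    have "concat (a # \<alpha>s) = map sum_list (a # \<alpha>s)"
      if "length (a # \<alpha>s) = length (concat (a # \<alpha>s))"
    proof -
      have "length xs + length (concat \<alpha>s) = length \<alpha>s" using that a by simp
      with IH(1) have "length xs = 0" "length \<alpha>s = length (concat \<alpha>s)" by linarith+
      then show ?thesis using IH(2) a by simp
    qed
    with le show ?case by blast
  qed simp
  obtain \<alpha>s where "concat \<alpha>s = \<alpha>" "[] \<notin> set \<alpha>s" "map sum_list \<alpha>s = \<beta>"
    using assms unfolding comp_le_def by blast
  with *[of \<alpha>s] show "length \<beta> \<le> length \<alpha>" "length \<beta> = length \<alpha> \<Longrightarrow> \<alpha> = \<beta>"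
    by (metis length_map)+
qed

lemma sum_list_concat_nat: "sum_list (concat xss) = sum_list (map sum_list xss :: nat list)"
  by (induction xss) auto

lemma finite_comp_le: "finite {\<beta>. comp_le \<alpha> \<beta>}"
proof (rule finite_subset)
  show "{\<beta>. comp_le \<alpha> \<beta>} \<subseteq> {\<beta>. set \<beta> \<subseteq> {..sum_list \<alpha>} \<and> length \<beta> \<le> length \<alpha>}"
  proof clarsimp
    fix \<beta> assume r: "comp_le \<alpha> \<beta>"
    then have "sum_list \<beta> = sum_list \<alpha>"
      by (auto simp: comp_le_def intro: sum_list_concat_nat[symmetric])
    then show "set \<beta> \<subseteq> {..sum_list \<alpha>} \<and> length \<beta> \<le> length \<alpha>"
      using comp_le_length[OF r] member_le_sum_list[of _ \<beta>] by auto
  qed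
  show "finite {\<beta>. set \<beta> \<subseteq> {..sum_list \<alpha>} \<and> length \<beta> \<le> length \<alpha>}"
    by (rule finite_lists_length_le) simp
qed

function moebius :: "nat list \<Rightarrow> nat list \<Rightarrow> int" where
  "moebius \<alpha> \<beta> =
     (if \<alpha> = \<beta> then 1
      else if comp_le \<alpha> \<beta>
           then - (\<Sum>\<gamma> | comp_le \<alpha> \<gamma> \<and> comp_le \<gamma> \<beta> \<and> \<gamma> \<noteq> \<beta>. moebius \<alpha> \<gamma>)
      else 0)"
  by auto
termination
proof (relation "measure (\<lambda>(\<alpha>, \<beta>). length \<alpha> - length \<beta>)")
  fix \<alpha> \<beta> \<gamma> :: "nat list"
  assume "\<gamma> \<in> {\<gamma>. comp_le \<alpha> \<gamma> \<and> comp_le \<gamma> \<beta> \<and> \<gamma> \<noteq> \<beta>}"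
  then have "length \<gamma> \<le> length \<alpha>" "length \<beta> < length \<gamma>"
    using comp_le_length[of \<alpha> \<gamma>] comp_le_length[of \<gamma> \<beta>] by (auto simp: le_less)
  then show "((\<alpha>, \<gamma>), \<alpha>, \<beta>) \<in> measure (\<lambda>(\<alpha>, \<beta>). length \<alpha> - length \<beta>)"
    by simp
qed simp

declare moebius.simps [simp del]


section \<open>Quasisymmetric functions\<close>

text \<open>
  The coefficient of a monomial \<open>m\<close> in \<open>M\<^sub>\<gamma>\<close> is the number of index sequences
  \<open>1 \<le> i\<^sub>1 < \<dots> < i\<^sub>k\<close> whose monomial is \<open>m\<close> (one or zero when \<open>\<gamma>\<close> is a composition).
\<close>

definition qM :: "nat list \<Rightarrow> 'a::field cseries" where
  "qM \<gamma> = (\<lambda>m. of_nat (card {is. length is = length \<gamma> \<and> 0 \<notin> set is \<and> sorted_wrt (<) is \<and>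
     (\<Sum>j<length \<gamma>. Poly_Mapping.single (is ! j) (\<gamma> ! j)) = m}))"

definition qF :: "nat list \<Rightarrow> 'a::field cseries" where
  "qF \<beta> = (\<Sum>\<alpha> | composition \<alpha> \<and> comp_le \<alpha> \<beta>. qM \<alpha>)"


section \<open>The projection\<close>

definition block_sizes :: "nat set list \<Rightarrow> nat list" where
  "block_sizes \<Phi> = map card \<Phi>"

text \<open>
  The linear map from the span of the \<open>M\<^sub>\<Phi>\<close> with \<open>M\<^sub>\<Phi> \<mapsto> M\<^bsub>\<rho>(\<Phi>)\<^esub>\<close>.  Outside this span the
  library's \<open>construct\<close> takes unspecified values; the lemmas at the end of the theory show that
  it is determined on the span.
\<close>

definition rho_proj :: "'a::field ncseries \<Rightarrow> 'a cseries" where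
  "rho_proj = vector_space_pair.construct scl scl (ncM ` {\<Phi>. \<exists>n. set_composition n \<Phi>})
     (\<lambda>f. qM (block_sizes (the_inv_into {\<Phi>. \<exists>n. set_composition n \<Phi>} ncM f)))"


section \<open>The compositions \<open>\<rho>\<^sub>C\<close> and \<open>\<rho>\<^sub>I\<close>\<close>

fun segments :: "nat set list \<Rightarrow> nat list list" where
  "segments [] = []"
| "segments [B] = [[card B]]"
| "segments (A # B # \<Phi>) =
     (if B >\<^sub>D A then [card A] # segments (B # \<Phi>)
      else (card A # hd (segments (B # \<Phi>))) # tl (segments (B # \<Phi>)))"

definition partial_sums :: "nat list \<Rightarrow> nat set" where
  "partial_sums \<gamma> = {sum_list (take j \<gamma>) | j. 1 \<le> j \<and> j < length \<gamma>}"

definition complement :: "nat list \<Rightarrow> nat list" where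
  "complement \<gamma> = (THE \<delta>. composition \<delta> \<and> sum_list \<delta> = sum_list \<gamma> \<and>
     partial_sums \<delta> = {1..<sum_list \<gamma>} - partial_sums \<gamma>)"

definition rho_C :: "nat set list \<Rightarrow> nat list" where
  "rho_C \<Phi> = map sum_list (segments \<Phi>)"

definition rho_I :: "nat set list \<Rightarrow> nat list" where
  "rho_I \<Phi> = concat (map complement (segments \<Phi>))"


section \<open>Well-definedness of the projection and of the complement\<close>

lemma word_blocks_surj:
  assumes "set_composition n \<Phi>"
  obtains w where "0 \<notin> set w" "word_blocks w = \<Phi>"
proof -
  let ?k = "length \<Phi>"
  define w where "w = map (\<lambda>i. Suc (LEAST j. j < ?k \<and> i \<in> \<Phi> ! j)) [1..<Suc n]"
  have part: "\<Union>(set \<Phi>) = {1..n}" "disjoint (set \<Phi>)" "{} \<notin> set \<Phi>" "distinct \<Phi>"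
    using assms by (auto simp: set_composition_def partition_on_def)
  have uniq: "(LEAST j. j < ?k \<and> i \<in> \<Phi> ! j) = j" if "j < ?k" "i \<in> \<Phi> ! j" for i j
  proof (rule Least_equality)
    fix l assume l: "l < ?k \<and> i \<in> \<Phi> ! l"
    then have "\<Phi> ! l = \<Phi> ! j"
      using that part(2) by (metis IntI disjointD emptyE nth_mem)
    then show "j \<le> l" using l that part(4) nth_eq_iff_index_eq by fastforce
  qed (use that in auto)
  have ex: "\<exists>j<?k. i \<in> \<Phi> ! j" if "i \<in> {1..n}" for i
    using that part(1) by (metis UnionE in_set_conv_nth)
  have sub: "i \<in> {1..n}" if "j < ?k" "i \<in> \<Phi> ! j" for i j
    using that part(1) nth_mem by blast
  have len: "length w = n" by (simp add: w_def)
  have wn: "w ! (i - 1) = Suc (LEAST j. j < ?k \<and> i \<in> \<Phi> ! j)" if "i \<in> {1..n}" for i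
    using that by (auto simp add: w_def nth_map_upt simp del: upt_Suc)
  have setw: "set w = {1..<Suc ?k}"
  proof
    show "set w \<subseteq> {1..<Suc ?k}"
    proof
      fix v assume "v \<in> set w"
      then obtain i where i: "i \<in> {1..n}" "v = Suc (LEAST j. j < ?k \<and> i \<in> \<Phi> ! j)"
        by (force simp: w_def simp del: upt_Suc)
      with ex[OF i(1)] uniq show "v \<in> {1..<Suc ?k}" by auto
    qed
    show "{1..<Suc ?k} \<subseteq> set w"
    proof
      fix v assume "v \<in> {1..<Suc ?k}"
      then have v: "v - 1 < ?k" "Suc (v - 1) = v" by auto
      then have "\<Phi> ! (v - 1) \<noteq> {}" using part(3) nth_mem by metis
      then obtain i where i: "i \<in> \<Phi> ! (v - 1)" by blast
      then have "w ! (i - 1) = v" "i \<in> {1..n}"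
        using wn[OF sub[OF v(1) i]] uniq[OF v(1) i] v sub[OF v(1) i] by auto
      moreover from this have "i - 1 < length w" using len by auto
      ultimately show "v \<in> set w" using nth_mem by blast
    qed
  qed
  have "word_blocks w = \<Phi>"
  proof (rule nth_equalityI)
    have sl: "sorted_list_of_set (set w) = [1..<Suc ?k]"
      unfolding setw by (rule sorted_list_of_set_range)
    show lenb: "length (word_blocks w) = ?k"
      by (simp add: word_blocks_def sl del: upt_Suc)
    fix l assume "l < length (word_blocks w)"
    then have l: "l < ?k" using lenb by simp
    have "word_blocks w ! l = {i \<in> {1..n}. w ! (i - 1) = Suc l}"
      using l by (simp add: word_blocks_def sl len del: upt_Suc)
    also have "\<dots> = \<Phi> ! l"
    proof safe
      fix i assume i: "i \<in> {1..n}" "w ! (i - 1) = Suc l"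
      with ex[OF i(1)] obtain j where "j < ?k" "i \<in> \<Phi> ! j" by blast
      with uniq[OF this] wn[OF i(1)] i(2) show "i \<in> \<Phi> ! l" by auto
    next
      fix i assume i: "i \<in> \<Phi> ! l"
      then show "w ! (i - 1) = Suc l" using wn[OF sub[OF l i]] uniq[OF l i] by simp
      show "i \<in> {1..n}" by (rule sub[OF l i])
    qed
    finally show "word_blocks w ! l = \<Phi> ! l" .
  qed
  moreover have "0 \<notin> set w" by (simp add: setw)
  ultimately show thesis using that by blast
qed

lemma inj_on_ncM: "inj_on (ncM :: nat set list \<Rightarrow> 'a::field ncseries) {\<Phi>. \<exists>n. set_composition n \<Phi>}"
proof (rule inj_onI, clarify)
  fix \<Phi> \<Psi> n m
  assume eq: "(ncM \<Phi> :: 'a ncseries) = ncM \<Psi>" and "set_composition n \<Phi>" "set_composition m \<Psi>"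
  then obtain w where w: "0 \<notin> set w" "word_blocks w = \<Phi>" using word_blocks_surj by blast
  have "(ncM \<Phi> :: 'a ncseries) w = ncM \<Psi> w" by (simp add: eq)
  then show "\<Phi> = \<Psi>" using w by (auto simp: ncM_def of_bool_def split: if_splits)
qed

lemma independent_ncM:
  "\<not> module.dependent scl ((ncM :: _ \<Rightarrow> 'a::field ncseries) ` {\<Phi>. \<exists>n. set_composition n \<Phi>})"
proof -
  interpret vector_space "scl :: 'a \<Rightarrow> 'a ncseries \<Rightarrow> 'a ncseries" by (rule vector_space_scl)
  have "u v = 0" if T: "finite T" "T \<subseteq> ncM ` {\<Phi>. \<exists>n. set_composition n \<Phi>}"
    and z: "(\<Sum>v\<in>T. scl (u v) v) = 0" and v: "v \<in> T" for T u and v :: "'a ncseries"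
  proof -
    obtain \<Phi> n where P: "v = ncM \<Phi>" "set_composition n \<Phi>" using T v by blast
    obtain w where w: "0 \<notin> set w" "word_blocks w = \<Phi>" using word_blocks_surj[OF P(2)] by blast
    have sum_app: "(\<Sum>v\<in>U. scl (u v) v) w = (\<Sum>v\<in>U. u v * v w)" if "finite U" for U
      using that by induction (auto simp: scl_def)
    have oth: "v' w = 0" if "v' \<in> T" "v' \<noteq> v" for v'
      using that T(2) w P by (auto simp: ncM_def)
    have "0 = (\<Sum>v\<in>T. u v * v w)" using sum_app[OF T(1)] z by simp
    also have "\<dots> = u v * v w + (\<Sum>v'\<in>T - {v}. u v' * v' w)"
      by (rule sum.remove[OF T(1) v])
    also have "(\<Sum>v'\<in>T - {v}. u v' * v' w) = 0"
      by (rule sum.neutral) (use oth in auto)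
    also have "u v * v w + 0 = u v" using w P by (simp add: ncM_def)
    finally show ?thesis by simp
  qed
  then show ?thesis unfolding dependent_explicit by blast
qed

lemma rho_proj_ncM:
  assumes "set_composition n \<Phi>"
  shows "rho_proj (ncM \<Phi> :: 'a::field ncseries) = qM (block_sizes \<Phi>)"
proof -
  interpret vector_space_pair "scl :: 'a \<Rightarrow> 'a ncseries \<Rightarrow> _" "scl :: 'a \<Rightarrow> 'a cseries \<Rightarrow> _"
    by (intro vector_space_pair.intro vector_space_scl)
  have mem: "\<Phi> \<in> {\<Phi>. \<exists>n. set_composition n \<Phi>}" using assms by blast
  show ?thesis
    unfolding rho_proj_def using construct_basis[OF independent_ncM imageI[OF mem]]
    by (simp add: the_inv_into_f_f[OF inj_on_ncM mem])
qed

lemma linear_rho_proj: "Vector_Spaces.linear scl scl (rho_proj :: 'a::field ncseries \<Rightarrow> 'a cseries)"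
proof -
  interpret vector_space_pair "scl :: 'a \<Rightarrow> 'a ncseries \<Rightarrow> _" "scl :: 'a \<Rightarrow> 'a cseries \<Rightarrow> _"
    by (intro vector_space_pair.intro vector_space_scl)
  show ?thesis unfolding rho_proj_def by (rule linear_construct[OF independent_ncM])
qed

lemma partial_sums_Cons:
  "partial_sums (a # \<gamma>) = (if \<gamma> = [] then {} else insert a ((+) a ` partial_sums \<gamma>))"
proof (cases "\<gamma> = []")
  case False
  have "{j. 1 \<le> j \<and> j < length (a # \<gamma>)} = insert 1 (Suc ` {j. 1 \<le> j \<and> j < length \<gamma>})"
  proof (intro set_eqI iffI)
    fix j assume "j \<in> {j. 1 \<le> j \<and> j < length (a # \<gamma>)}"
    then show "j \<in> insert 1 (Suc ` {j. 1 \<le> j \<and> j < length \<gamma>})"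
      by (cases "j = 1") (auto intro!: image_eqI[of _ _ "j - 1"])
  qed (use False in auto)
  then show ?thesis using False
    by (simp add: partial_sums_def setcompr_eq_image image_image)
qed (auto simp: partial_sums_def)

lemma partial_sums_pos: "composition \<gamma> \<Longrightarrow> x \<in> partial_sums \<gamma> \<Longrightarrow> 0 < x \<and> x < sum_list \<gamma>"
proof (induction \<gamma> arbitrary: x)
  case (Cons a \<gamma>)
  have c: "composition \<gamma>" "0 < a" using Cons.prems by (auto simp: composition_def)
  have "\<gamma> \<noteq> []" using Cons.prems by (auto simp: partial_sums_Cons)
  then have "0 < sum_list \<gamma>" using c by (cases \<gamma>) (auto simp: composition_def)
  then show ?case using Cons c by (auto simp: partial_sums_Cons split: if_splits)
qed (simp add: partial_sums_def)

lemma composition_with_partial_sums: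
  "S \<subseteq> {1..<m} \<Longrightarrow> \<exists>\<delta>. composition \<delta> \<and> sum_list \<delta> = m \<and> partial_sums \<delta> = S"
proof (induction m arbitrary: S rule: less_induct)
  case (less m)
  show ?case
  proof (cases "S = {}")
    case True
    then show ?thesis
      by (intro exI[of _ "if m = 0 then [] else [m]"])
         (auto simp: composition_def partial_sums_def)
  next
    case False
    define d where "d = Min S"
    have fin: "finite S" using less.prems finite_subset by blast
    have d: "d \<in> S" "\<And>x. x \<in> S \<Longrightarrow> d \<le> x" using fin False by (auto simp: d_def)
    then have dm: "0 < d" "d < m" using less.prems by (auto dest!: subsetD)
    define T where "T = (\<lambda>x. x - d) ` (S - {d})"
    have "T \<subseteq> {1..<m - d}"
    proof
      fix y assume "y \<in> T"
      then obtain x where "x \<in> S" "x \<noteq> d" "y = x - d" by (auto simp: T_def)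
      then show "y \<in> {1..<m - d}" using d(2)[of x] less.prems by (auto dest!: subsetD)
    qed
    then obtain \<delta> where \<delta>: "composition \<delta>" "sum_list \<delta> = m - d" "partial_sums \<delta> = T"
      using less.IH[of "m - d" T] dm by auto
    have "(+) d ` T = S - {d}"
      using d(2) by (force simp: T_def image_image)
    moreover have "\<delta> \<noteq> []" using \<delta>(2) dm by auto
    ultimately have "partial_sums (d # \<delta>) = S" using d(1) \<delta>(3) by (auto simp: partial_sums_Cons)
    then show ?thesis using \<delta> dm by (intro exI[of _ "d # \<delta>"]) (auto simp: composition_def)
  qed
qed

lemma composition_eqI:
  "composition \<gamma> \<Longrightarrow> composition \<delta> \<Longrightarrow> sum_list \<gamma> = sum_list \<delta> \<Longrightarrow>
   partial_sums \<gamma> = partial_sums \<delta> \<Longrightarrow> \<gamma> = \<delta>"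
proof (induction \<gamma> arbitrary: \<delta>)
  case Nil
  then show ?case by (cases \<delta>) (auto simp: composition_def)
next
  case (Cons a \<gamma>)
  then obtain b \<delta>' where \<delta>: "\<delta> = b # \<delta>'" by (cases \<delta>) (auto simp: composition_def)
  have c: "composition \<gamma>" "composition \<delta>'" "0 < a" "0 < b"
    using Cons.prems by (auto simp: composition_def \<delta>)
  show ?case
  proof (cases "\<gamma> = [] \<or> \<delta>' = []")
    case True
    then have "\<gamma> = []" "\<delta>' = []" using Cons.prems(4) by (auto simp: \<delta> partial_sums_Cons split: if_splits)
    then show ?thesis using Cons.prems by (simp add: \<delta>)
  next
    case False
    then have eq: "insert a ((+) a ` partial_sums \<gamma>) = insert b ((+) b ` partial_sums \<delta>')"
      using Cons.prems(4) by (simp add: \<delta> partial_sums_Cons)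
    have "a \<in> insert b ((+) b ` partial_sums \<delta>')" "b \<in> insert a ((+) a ` partial_sums \<gamma>)"
      using eq by blast+
    then have ab: "a = b" by auto
    have "a \<notin> (+) a ` partial_sums \<gamma>" "b \<notin> (+) b ` partial_sums \<delta>'"
      using partial_sums_pos[OF c(1), of 0] partial_sums_pos[OF c(2), of 0] by auto
    then have "(+) a ` partial_sums \<gamma> = (+) a ` partial_sums \<delta>'"
      using eq ab by (metis insert_ident)
    then have "partial_sums \<gamma> = partial_sums \<delta>'" by (simp add: inj_image_eq_iff)
    then have "\<gamma> = \<delta>'" using Cons.IH[of \<delta>'] Cons.prems(3) c ab by (simp add: \<delta>)
    then show ?thesis using ab \<delta> by simp
  qed
qed

lemma complement:
  "composition (complement \<gamma>)" "sum_list (complement \<gamma>) = sum_list \<gamma>"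
  "partial_sums (complement \<gamma>) = {1..<sum_list \<gamma>} - partial_sums \<gamma>"
proof -
  have "\<exists>!\<delta>. composition \<delta> \<and> sum_list \<delta> = sum_list \<gamma> \<and>
          partial_sums \<delta> = {1..<sum_list \<gamma>} - partial_sums \<gamma>"
    by (rule ex_ex1I)
       (use composition_with_partial_sums[OF Diff_subset] composition_eqI in \<open>simp_all\<close>)
  from theI'[OF this, folded complement_def]
  show "composition (complement \<gamma>)" "sum_list (complement \<gamma>) = sum_list \<gamma>"
    "partial_sums (complement \<gamma>) = {1..<sum_list \<gamma>} - partial_sums \<gamma>" by auto
qed

end

theory Submission
  imports Defs
begin

text \<open>
  A composition of \<open>m\<close> is encoded by its set of partial sums in \<open>{1..<m}\<close>; refinement becomes reverse
  inclusion.  Let \<open>C\<close> and \<open>R\<close> be the sets of \<open>\<rho>\<^sub>C(\<Phi>)\<close> and \<open>\<rho>(\<Phi>)\<close>, so that \<open>\<rho>\<^sub>I(\<Phi>)\<close> has the set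
  \<open>C \<union> ({1..<n} - R)\<close>.  A placement in \<open>LDD(\<Phi>)\<close> amounts to a choice of descents at which to merge
  adjacent blocks, hence \<open>\<rho>(P\<^sub>\<Phi>)\<close> is the sum of the \<open>M\<^sub>B\<close> with \<open>C \<subseteq> B \<subseteq> R\<close>.  As \<open>F\<^sub>A\<close> is the sum of the
  \<open>M\<^sub>B\<close> with \<open>B \<supseteq> A\<close>, the signed sum of the \<open>F\<^sub>A\<close> over \<open>C \<subseteq> A \<subseteq> C \<union> ({1..<n} - R)\<close> collapses to the same sum.
\<close>

section \<open>Alternating sums over intervals of sets\<close>

text \<open>Subsets of \<open>insert x A\<close> come in pairs \<open>X\<close>,
  \<open>insert x X\<close> with opposite signs, so everything cancels once there is an element to
  toggle.\<close>

lemma sum_Pow_alternating: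
  assumes "finite A"
  shows "(\<Sum>X\<in>Pow A. (-1) ^ card X) = (of_bool (A = {}) :: 'a::comm_ring_1)"
  using assms
proof (induction A)
  case (insert x A)
  have inj: "inj_on (insert x) (Pow A)" using insert.hyps by (auto simp: inj_on_def)
  have "(\<Sum>X\<in>insert x ` Pow A. (-1) ^ card X :: 'a) = (\<Sum>X\<in>Pow A. - ((-1) ^ card X))"
    unfolding sum.reindex[OF inj] comp_def
  proof (rule sum.cong)
    fix X assume "X \<in> Pow A"
    then have "x \<notin> X" "finite X" using insert.hyps finite_subset by auto
    then show "(-1) ^ card (insert x X) = (- ((-1) ^ card X) :: 'a)" by simp
  qed simp
  moreover have "Pow A \<inter> insert x ` Pow A = {}" using insert.hyps by auto
  ultimately show ?case using insert.hyps
    by (simp add: Pow_insert sum.union_disjoint sum_negf)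
qed simp

text \<open>The interval from \<open>C\<close> to \<open>J\<close> is a Boolean lattice:
  \<open>X - C\<close> and \<open>J - X\<close> each run once through \<open>Pow (J - C)\<close>.
  The first form serves the inversion of the \<open>qF\<close> sums, the second the Moebius
  function.\<close>

lemma sum_interval_alternating:
  assumes "finite J" "C \<subseteq> J"
  shows "(\<Sum>X | C \<subseteq> X \<and> X \<subseteq> J. (-1) ^ card (X - C)) = (of_bool (J = C) :: 'a::comm_ring_1)"
    and "(\<Sum>X | C \<subseteq> X \<and> X \<subseteq> J. (-1) ^ card (J - X)) = (of_bool (J = C) :: 'a::comm_ring_1)"
proof -
  have "bij_betw (\<lambda>X. X - C) {X. C \<subseteq> X \<and> X \<subseteq> J} (Pow (J - C))"
    by (rule bij_betw_byWitness[where f' = "\<lambda>X. X \<union> C"]) (use assms in auto)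
  from sum.reindex_bij_betw[OF this, of "\<lambda>X. (-1) ^ card X :: 'a"]
  show "(\<Sum>X | C \<subseteq> X \<and> X \<subseteq> J. (-1) ^ card (X - C)) = (of_bool (J = C) :: 'a)"
    using assms by (auto simp: sum_Pow_alternating)
  have "bij_betw (\<lambda>X. J - X) {X. C \<subseteq> X \<and> X \<subseteq> J} (Pow (J - C))"
    by (rule bij_betw_byWitness[where f' = "\<lambda>X. J - X"]) (use assms in auto)
  from sum.reindex_bij_betw[OF this, of "\<lambda>X. (-1) ^ card X :: 'a"]
  show "(\<Sum>X | C \<subseteq> X \<and> X \<subseteq> J. (-1) ^ card (J - X)) = (of_bool (J = C) :: 'a)"
    using assms by (auto simp: sum_Pow_alternating)
qed

lemma sum_fun_apply: "(\<Sum>i\<in>A. f i) x = (\<Sum>i\<in>A. f i x)"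
  by (induction A rule: infinite_finite_induct) auto


section \<open>Refinement as reverse inclusion of partial sums\<close>

lemma partial_sums_append:
  assumes "xs \<noteq> []" "ys \<noteq> []"
  shows "partial_sums (xs @ ys) =
    partial_sums xs \<union> insert (sum_list xs) ((+) (sum_list xs) ` partial_sums ys)"
  using assms(1)
proof (induction xs)
  case (Cons x xs)
  then show ?case using assms(2)
    by (cases "xs = []") (auto simp: partial_sums_Cons image_Un image_image add.assoc)
qed simp

lemma composition_sum_list_pos: "composition \<gamma> \<Longrightarrow> \<gamma> \<noteq> [] \<Longrightarrow> 0 < sum_list \<gamma>"
  by (cases \<gamma>) (auto simp: composition_def)

lemma partial_sums_subset: "composition \<gamma> \<Longrightarrow> partial_sums \<gamma> \<subseteq> {1..<sum_list \<gamma>}"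
  using partial_sums_pos by fastforce

lemma finite_partial_sums: "finite (partial_sums \<gamma>)"
  by (induction \<gamma>) (auto simp: partial_sums_Cons partial_sums_def[of "[]"])

text \<open>Every part but the last closes off one partial sum, and positive parts keep these sums
  distinct.\<close>

lemma length_composition:
  assumes "composition \<gamma>" "\<gamma> \<noteq> []"
  shows "length \<gamma> = Suc (card (partial_sums \<gamma>))"
  using assms
proof (induction \<gamma>)
  case (Cons a \<gamma>)
  show ?case
  proof (cases "\<gamma> = []")
    case False
    have c: "composition \<gamma>" using Cons.prems by (simp add: composition_def)
    then have "a \<notin> (+) a ` partial_sums \<gamma>" using partial_sums_pos[of \<gamma> 0] by auto
    then show ?thesis using Cons.IH[OF c False] False
      by (simp add: partial_sums_Cons finite_partial_sums card_image)
  qed (simp add: partial_sums_Cons)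
qed simp

lemma comp_le_sum_list: "comp_le \<alpha> \<beta> \<Longrightarrow> sum_list \<alpha> = sum_list \<beta>"
  by (auto simp: comp_le_def sum_list_concat_nat)

lemma comp_le_composition:
  assumes "comp_le \<alpha> \<beta>" "composition \<alpha>"
  shows "composition \<beta>"
proof -
  obtain \<alpha>s where s: "concat \<alpha>s = \<alpha>" "[] \<notin> set \<alpha>s" "map sum_list \<alpha>s = \<beta>"
    using assms(1) unfolding comp_le_def by blast
  have "0 < sum_list x" if "x \<in> set \<alpha>s" for x
    using that s assms(2) by (intro composition_sum_list_pos) (auto simp: composition_def)
  then show ?thesis unfolding s(3)[symmetric] composition_def by (metis imageE less_irrefl list.set_map)
qed

text \<open>The group boundaries are among the partial sums of the concatenation; nonempty groups
  keep these boundaries strictly inside the list.\<close>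

lemma partial_sums_map_sum_list:
  "[] \<notin> set \<alpha>s \<Longrightarrow> partial_sums (map sum_list \<alpha>s) \<subseteq> partial_sums (concat \<alpha>s)"
proof (induction \<alpha>s)
  case (Cons x \<alpha>s)
  show ?case
  proof (cases "\<alpha>s = []")
    case False
    then have "concat \<alpha>s \<noteq> []" "x \<noteq> []" using Cons.prems by (cases \<alpha>s; auto)+
    then show ?thesis using Cons False by (auto simp: partial_sums_Cons partial_sums_append)
  qed (simp add: partial_sums_Cons)
qed simp

lemma comp_le_Cons: "comp_le \<alpha> \<beta> \<Longrightarrow> comp_le (a # \<alpha>) (a # \<beta>)"
  unfolding comp_le_def by (elim exE, rule_tac x = "[a] # \<alpha>s" in exI) simp

text \<open>Here \<open>a\<close> joins the first group, whereas in \<open>comp_le_Cons\<close> it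
  forms a group of its own. The two cases are the steps that build a grouping from the left.\<close>

lemma comp_le_Cons_merge: "comp_le \<alpha> (b # \<beta>) \<Longrightarrow> comp_le (a # \<alpha>) ((a + b) # \<beta>)"
  unfolding comp_le_def
  by (elim exE, rule_tac x = "(a # hd \<alpha>s) # tl \<alpha>s" in exI) (auto simp: neq_Nil_conv)

text \<open>The grouping is built by comparing the first parts \<open>a\<close> and
  \<open>b\<close>. If \<open>b = a\<close>, a group is complete; if \<open>b > a\<close>, the rest
  of \<open>\<alpha>\<close> must still fill \<open>b - a\<close>; and \<open>b < a\<close> is
  impossible, since \<open>b\<close> would be a partial sum of \<open>a # \<alpha>\<close> below the
  least one, \<open>a\<close>.\<close>

lemma comp_le_if_partial_sums:
  assumes "composition \<alpha>" "composition \<beta>" "sum_list \<alpha> = sum_list \<beta>"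
    "partial_sums \<beta> \<subseteq> partial_sums \<alpha>"
  shows "comp_le \<alpha> \<beta>"
  using assms
proof (induction \<alpha> arbitrary: \<beta>)
  case Nil
  then have "\<beta> = []" using composition_sum_list_pos[of \<beta>] by (metis less_irrefl sum_list.Nil)
  then show ?case by (auto simp: comp_le_def)
next
  case (Cons a \<alpha>)
  then obtain b \<beta>' where \<beta>: "\<beta> = b # \<beta>'" by (cases \<beta>) (auto simp: composition_def)
  have c: "composition \<alpha>" "0 < a" "composition \<beta>'" "0 < b"
    using Cons.prems by (auto simp: composition_def \<beta>)
  show ?case
  proof (cases "\<alpha> = []")
    case True
    then have "\<beta>' = []" using Cons.prems(4) by (auto simp: \<beta> partial_sums_Cons split: if_splits)
    then show ?thesis using True \<beta> Cons.prems(3)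
      by (intro exI[of _ "[[a]]"] comp_le_def[THEN iffD2]) auto
  next
    case False
    have pos: "0 < sum_list \<alpha>" using composition_sum_list_pos c False by blast
    have sub: "partial_sums \<beta> \<subseteq> insert a ((+) a ` partial_sums \<alpha>)"
      using Cons.prems(4) False by (simp add: partial_sums_Cons)
    consider "b = a" | "b > a" | "b < a" by linarith
    then show ?thesis
    proof cases
      case 1
      then have "\<beta>' \<noteq> []" using Cons.prems(3) pos \<beta> by auto
      then have "(+) a ` partial_sums \<beta>' \<subseteq> insert a ((+) a ` partial_sums \<alpha>)"
        using sub 1 by (auto simp: \<beta> partial_sums_Cons)
      moreover have "a \<notin> (+) a ` partial_sums \<beta>'" using partial_sums_pos[OF c(3), of 0] by auto
      ultimately have "partial_sums \<beta>' \<subseteq> partial_sums \<alpha>" by auto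
      then show ?thesis using Cons.IH[OF c(1,3)] Cons.prems(3) 1 \<beta> by (auto intro: comp_le_Cons)
    next
      case 2
      have "partial_sums ((b - a) # \<beta>') \<subseteq> partial_sums \<alpha>"
      proof
        fix y assume y: "y \<in> partial_sums ((b - a) # \<beta>')"
        then have "a + y \<in> partial_sums \<beta>"
          using 2 by (auto simp: \<beta> partial_sums_Cons split: if_splits)
        moreover have "y > 0" using y 2 by (auto simp: partial_sums_Cons split: if_splits)
        ultimately show "y \<in> partial_sums \<alpha>" using sub by auto
      qed
      then have "comp_le \<alpha> ((b - a) # \<beta>')"
        using Cons.IH[OF c(1), of "(b - a) # \<beta>'"] c(3) 2 Cons.prems(3) \<beta>
        by (auto simp: composition_def)
      then show ?thesis using comp_le_Cons_merge[of \<alpha> "b - a" \<beta>' a] 2 \<beta> by simp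
    next
      case 3
      then have "\<beta>' \<noteq> []" using Cons.prems(3) \<beta> by auto
      then have "b \<in> insert a ((+) a ` partial_sums \<alpha>)" using sub by (auto simp: \<beta> partial_sums_Cons)
      then show ?thesis using 3 by auto
    qed
  qed
qed

lemma comp_le_iff_partial_sums:
  assumes "composition \<alpha>" "composition \<beta>"
  shows "comp_le \<alpha> \<beta> \<longleftrightarrow> sum_list \<alpha> = sum_list \<beta> \<and> partial_sums \<beta> \<subseteq> partial_sums \<alpha>"
proof
  assume "comp_le \<alpha> \<beta>"
  moreover from this have "partial_sums \<beta> \<subseteq> partial_sums \<alpha>"
    unfolding comp_le_def using partial_sums_map_sum_list by blast
  ultimately show "sum_list \<alpha> = sum_list \<beta> \<and> partial_sums \<beta> \<subseteq> partial_sums \<alpha>"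
    using comp_le_sum_list by blast
qed (use assms comp_le_if_partial_sums in blast)

lemma bij_betw_partial_sums:
  "bij_betw partial_sums {\<gamma>. composition \<gamma> \<and> sum_list \<gamma> = m} (Pow {1..<m})"
proof (rule bij_betwI')
  fix S assume "S \<in> Pow {1..<m}"
  then show "\<exists>\<gamma>\<in>{\<gamma>. composition \<gamma> \<and> sum_list \<gamma> = m}. S = partial_sums \<gamma>"
    using composition_with_partial_sums by blast
qed (use composition_eqI partial_sums_subset in auto)

text \<open>Carries sums over a refinement interval to sums over a Boolean interval. The order is
  reversed, so the coarser \<open>\<beta>\<close> gives the lower end. That each
  \<open>\<gamma>\<close> is a composition is inherited from \<open>\<alpha>\<close>.\<close>

lemma bij_betw_partial_sums_interval:
  assumes "composition \<alpha>" "composition \<beta>" "sum_list \<alpha> = sum_list \<beta>"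
  shows "bij_betw partial_sums {\<gamma>. comp_le \<alpha> \<gamma> \<and> comp_le \<gamma> \<beta>}
           {S. partial_sums \<beta> \<subseteq> S \<and> S \<subseteq> partial_sums \<alpha>}"
proof (rule bij_betw_subset[OF bij_betw_partial_sums[of "sum_list \<alpha>"]])
  have eq: "comp_le \<alpha> \<gamma> \<and> comp_le \<gamma> \<beta> \<longleftrightarrow> composition \<gamma> \<and> sum_list \<gamma> = sum_list \<alpha> \<and>
      partial_sums \<gamma> \<subseteq> partial_sums \<alpha> \<and> partial_sums \<beta> \<subseteq> partial_sums \<gamma>" for \<gamma>
    using assms comp_le_composition[of \<alpha> \<gamma>] comp_le_iff_partial_sums[of \<alpha> \<gamma>]
      comp_le_iff_partial_sums[of \<gamma> \<beta>] by auto
  then show "{\<gamma>. comp_le \<alpha> \<gamma> \<and> comp_le \<gamma> \<beta>} \<subseteq> {\<gamma>. composition \<gamma> \<and> sum_list \<gamma> = sum_list \<alpha>}" by auto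
  show "partial_sums ` {\<gamma>. comp_le \<alpha> \<gamma> \<and> comp_le \<gamma> \<beta>} =
      {S. partial_sums \<beta> \<subseteq> S \<and> S \<subseteq> partial_sums \<alpha>}"
  proof (intro set_eqI iffI)
    fix S assume S: "S \<in> {S. partial_sums \<beta> \<subseteq> S \<and> S \<subseteq> partial_sums \<alpha>}"
    then have "S \<subseteq> {1..<sum_list \<alpha>}" using partial_sums_subset[OF assms(1)] by blast
    then obtain \<gamma> where "composition \<gamma>" "sum_list \<gamma> = sum_list \<alpha>" "partial_sums \<gamma> = S"
      using composition_with_partial_sums by blast
    then show "S \<in> partial_sums ` {\<gamma>. comp_le \<alpha> \<gamma> \<and> comp_le \<gamma> \<beta>}"
      using S eq by blast
  qed (use eq in auto)
qed

section \<open>The Moebius function of refinement as a sign\<close>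

lemma card_partial_sums_diff:
  assumes "composition \<alpha>" "composition \<beta>" "comp_le \<alpha> \<beta>"
  shows "card (partial_sums \<alpha> - partial_sums \<beta>) = length \<alpha> - length \<beta>"
proof (cases "\<alpha> = []")
  case True
  \<comment> \<open>Both sides are 0, the right one by truncated subtraction.\<close>
  then show ?thesis by (simp add: partial_sums_def)
next
  case False
  then have "\<beta> \<noteq> []"
    using composition_sum_list_pos[OF assms(1)] comp_le_sum_list[OF assms(3)] by auto
  moreover have "partial_sums \<beta> \<subseteq> partial_sums \<alpha>"
    using assms comp_le_iff_partial_sums by blast
  ultimately show ?thesis using False length_composition assms
    by (simp add: card_Diff_subset finite_partial_sums)
qed

text \<open>The recursion makes the values on the interval from \<open>\<alpha>\<close> to
  \<open>\<beta>\<close> add up to 0, and so do the signs, by the alternating sum over a Boolean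
  interval. By induction the two agree at every \<open>\<gamma> \<noteq> \<beta>\<close>, hence also
  at \<open>\<beta>\<close>.\<close>

lemma moebius_partial_sums:
  assumes "composition \<alpha>" "composition \<beta>" "comp_le \<alpha> \<beta>"
  shows "moebius \<alpha> \<beta> = (-1) ^ card (partial_sums \<alpha> - partial_sums \<beta>)"
  using assms
proof (induction \<alpha> \<beta> rule: moebius.induct)
  case (1 \<alpha> \<beta>)
  show ?case
  proof (cases "\<alpha> = \<beta>")
    case True
    then show ?thesis by (simp add: moebius.simps)
  next
    case False
    let ?I = "{\<gamma>. comp_le \<alpha> \<gamma> \<and> comp_le \<gamma> \<beta>}"
    let ?s = "\<lambda>\<gamma>. (-1) ^ card (partial_sums \<alpha> - partial_sums \<gamma>) :: int"
    have eq: "sum_list \<alpha> = sum_list \<beta>" using 1 comp_le_sum_list by blast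
    have sub: "partial_sums \<beta> \<subseteq> partial_sums \<alpha>" using 1 comp_le_iff_partial_sums by blast
    have ne: "partial_sums \<alpha> \<noteq> partial_sums \<beta>" using composition_eqI eq False 1 by blast
    have fin: "finite ?I" by (rule finite_subset[OF _ finite_comp_le[of \<alpha>]]) auto
    have mem: "\<beta> \<in> ?I" using "1.prems" by (auto simp: comp_le_iff_partial_sums)
    have "(\<Sum>\<gamma>\<in>?I. ?s \<gamma>) =
        (\<Sum>X | partial_sums \<beta> \<subseteq> X \<and> X \<subseteq> partial_sums \<alpha>. (-1) ^ card (partial_sums \<alpha> - X))"
      by (rule sum.reindex_bij_betw[OF bij_betw_partial_sums_interval]) (use 1 eq in auto)
    also have "\<dots> = 0" using sum_interval_alternating(2)[OF finite_partial_sums sub] ne by simp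
    finally have "?s \<beta> + (\<Sum>\<gamma>\<in>?I - {\<beta>}. ?s \<gamma>) = 0" using sum.remove[OF fin mem, of ?s] by simp
    moreover have "(\<Sum>\<gamma> | comp_le \<alpha> \<gamma> \<and> comp_le \<gamma> \<beta> \<and> \<gamma> \<noteq> \<beta>. moebius \<alpha> \<gamma>) = (\<Sum>\<gamma>\<in>?I - {\<beta>}. ?s \<gamma>)"
    proof (rule sum.cong)
      fix \<gamma> assume "\<gamma> \<in> ?I - {\<beta>}"
      then have g: "\<gamma> \<in> {\<gamma>. comp_le \<alpha> \<gamma> \<and> comp_le \<gamma> \<beta> \<and> \<gamma> \<noteq> \<beta>}" by auto
      then have "composition \<gamma>" using "1.prems" comp_le_composition by blast
      then show "moebius \<alpha> \<gamma> = ?s \<gamma>" using "1.IH"[OF False "1.prems"(3) g] "1.prems" g by blast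
    qed auto
    ultimately show ?thesis using False "1.prems"(3) by (simp add: moebius.simps[of \<alpha> \<beta>])
  qed
qed

lemma moebius_composition:
  assumes "composition \<alpha>" "composition \<beta>" "comp_le \<alpha> \<beta>"
  shows "moebius \<alpha> \<beta> = (-1) ^ (length \<alpha> - length \<beta>)"
  using assms by (simp add: moebius_partial_sums card_partial_sums_diff)


section \<open>Partial sums of the segment compositions\<close>

lemma segments_nonempty: "[] \<notin> set (segments \<Phi>)" "\<Phi> \<noteq> [] \<Longrightarrow> segments \<Phi> \<noteq> []"
  by (induction \<Phi> rule: segments.induct) (auto dest: list.set_sel(2))

lemma concat_segments: "concat (segments \<Phi>) = block_sizes \<Phi>"
proof (induction \<Phi> rule: segments.induct)
  case (3 A B \<Phi>)
  then show ?case using segments_nonempty(2)[of "B # \<Phi>"]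
    by (cases "segments (B # \<Phi>)") (auto simp: block_sizes_def)
qed (auto simp: block_sizes_def)

text \<open>The segments themselves are the required grouping.\<close>

lemma comp_le_rho_C: "comp_le (block_sizes \<Phi>) (rho_C \<Phi>)"
  unfolding comp_le_def rho_C_def using concat_segments segments_nonempty(1) by blast

lemma sum_list_complements:
  "sum_list (concat (map complement ss)) = sum_list (concat ss)"
  by (induction ss) (auto simp: complement)

lemma shift_interval:
  assumes "0 < (a::nat)" "0 < b"
  shows "{1..<a + b} = {1..<a} \<union> insert a ((+) a ` {1..<b})"
proof -
  have "(+) a ` {1..<b} = {a + 1..<a + b}" by (simp add: add.commute)
  then show ?thesis using assms by (auto simp del: image_add_atLeastLessThan)
qed

text \<open>Complementing each segment flips the points inside the segments and leaves the
  boundaries between them in place. The boundaries, which are the partial sums of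
  \<open>map sum_list ss\<close>, must therefore be added to the global complement.\<close>

lemma partial_sums_complements:
  assumes "[] \<notin> set ss" "composition (concat ss)"
  shows "partial_sums (concat (map complement ss)) =
    partial_sums (map sum_list ss) \<union> ({1..<sum_list (concat ss)} - partial_sums (concat ss))"
  using assms
proof (induction ss)
  case Nil
  then show ?case by (simp add: partial_sums_def)
next
  case (Cons s ss)
  have c: "composition s" "composition (concat ss)" "s \<noteq> []" "[] \<notin> set ss"
    using Cons.prems by (auto simp: composition_def)
  have IH: "partial_sums (concat (map complement ss)) =
      partial_sums (map sum_list ss) \<union> ({1..<sum_list (concat ss)} - partial_sums (concat ss))"
    using Cons.IH c by blast
  show ?case
  proof (cases "ss = []")
    case True
    then show ?thesis by (simp add: complement partial_sums_Cons)
  next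
    case False
    then have ne: "concat ss \<noteq> []" using c(4) by (cases ss) auto
    define a b where "a = sum_list s" and "b = sum_list (concat ss)"
    have pos: "0 < a" "0 < b" using composition_sum_list_pos c ne by (auto simp: a_def b_def)
    have ne': "complement s \<noteq> []" "concat (map complement ss) \<noteq> []"
      using pos complement(2)[of s] sum_list_complements[of ss]
      unfolding a_def b_def by (metis less_irrefl sum_list.Nil)+
    let ?X = "partial_sums s" and ?Y = "partial_sums (concat ss)"
      and ?C = "partial_sums (map sum_list ss)"
    have X: "?X \<subseteq> {1..<a}" and Y: "?Y \<subseteq> {1..<b}"
      unfolding a_def b_def using partial_sums_subset c by blast+
    \<comment> \<open>Once the interval is split at \<open>a\<close> into named pieces, only their
      disjointness and the inclusions of \<open>?X\<close> and of the shifted \<open>?Y\<close>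
      matter, and the identity is Boolean.\<close>
    have *: "({1..<a} - ?X) \<union> insert a ((+) a ` (?C \<union> ({1..<b} - ?Y))) =
        insert a ((+) a ` ?C) \<union> ({1..<a + b} - (?X \<union> insert a ((+) a ` ?Y)))"
    proof -
      define P Q where "P = {1..<a}" and "Q = (+) a ` {1..<b}"
      have U: "{1..<a + b} = P \<union> insert a Q" using shift_interval[OF pos] by (simp only: P_def Q_def)
      have D: "(+) a ` ({1..<b} - ?Y) = Q - (+) a ` ?Y"
        unfolding Q_def by (rule image_set_diff) simp
      have "P \<inter> Q = {}" "a \<notin> P" "a \<notin> Q" "?X \<subseteq> P" "(+) a ` ?Y \<subseteq> Q"
        using X Y by (auto simp: P_def Q_def simp del: image_add_atLeastLessThan)
      then show ?thesis unfolding U image_Un D P_def[symmetric] by blast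
    qed
    have "partial_sums (concat (map complement (s # ss))) =
        ({1..<a} - ?X) \<union> insert a ((+) a ` (?C \<union> ({1..<b} - ?Y)))"
      using partial_sums_append[OF ne'] unfolding IH complement a_def b_def by simp
    also have "\<dots> = partial_sums (map sum_list (s # ss)) \<union> ({1..<a + b} - partial_sums (concat (s # ss)))"
      unfolding * using False partial_sums_append[OF c(3) ne]
      by (simp only: concat.simps list.map partial_sums_Cons a_def map_is_Nil_conv if_False)
    finally show ?thesis by (simp add: a_def b_def)
  qed
qed

lemma composition_rho_I: "composition (rho_I \<Phi>)"
  using complement(1) by (auto simp: rho_I_def composition_def)

lemma sum_list_rho_I: "sum_list (rho_I \<Phi>) = sum_list (block_sizes \<Phi>)"
  by (simp add: rho_I_def sum_list_complements concat_segments)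

lemma partial_sums_rho_I:
  assumes "composition (block_sizes \<Phi>)"
  shows "partial_sums (rho_I \<Phi>) = partial_sums (rho_C \<Phi>) \<union>
    ({1..<sum_list (block_sizes \<Phi>)} - partial_sums (block_sizes \<Phi>))"
  using partial_sums_complements[OF segments_nonempty(1), of \<Phi>] assms
  by (simp add: rho_I_def rho_C_def concat_segments)


section \<open>The column unions of a placement\<close>

text \<open>A recursive form of \<open>LDD\<close>. The starting column \<open>k\<close> is a
  parameter because the tail may start in column \<open>k\<close> or \<open>Suc k\<close>.\<close>

fun placements :: "nat \<Rightarrow> nat set list \<Rightarrow> nat list set" where
  "placements k [] = {[]}"
| "placements k [A] = {[k]}"
| "placements k (A # B # \<Phi>) = (#) k `
     (placements (Suc k) (B # \<Phi>) \<union> (if A >\<^sub>D B then placements k (B # \<Phi>) else {}))"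

lemma mem_placements_iff:
  "c \<in> placements k \<Phi> \<longleftrightarrow> length c = length \<Phi> \<and> (\<Phi> \<noteq> [] \<longrightarrow> c ! 0 = k) \<and>
     (\<forall>i. Suc i < length \<Phi> \<longrightarrow>
        (if \<Phi> ! i >\<^sub>D \<Phi> ! Suc i then c ! Suc i = c ! i \<or> c ! Suc i = c ! i + 1
         else c ! Suc i = c ! i + 1))"
proof (induction k \<Phi> arbitrary: c rule: placements.induct)
  case (2 k A)
  then show ?case by (auto simp: length_Suc_conv)
next
  case (3 k A B \<Phi>)
  \<comment> \<open>Separates the condition on the first two rows from the conditions on the tail,
    which are those of the induction hypothesis.\<close>
  have all: "(\<forall>i. P i) \<longleftrightarrow> P 0 \<and> (\<forall>i. P (Suc i))" for P :: "nat \<Rightarrow> bool"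
    by (metis not0_implies_Suc)
  show ?case
  proof (cases c)
    case (Cons x t)
    show ?thesis
      unfolding Cons by (subst all) (auto simp: "3.IH" image_iff)
  qed auto
qed auto

lemma LDD_eq_placements: "LDD \<Phi> = placements 1 \<Phi>"
  by (rule set_eqI) (simp only: LDD_def mem_placements_iff mem_Collect_eq)

lemma finite_placements: "finite (placements k \<Phi>)"
  by (induction k \<Phi> rule: placements.induct) auto

lemma placements_lower_bound: "c \<in> placements k \<Phi> \<Longrightarrow> y \<in> set c \<Longrightarrow> k \<le> y"
  by (induction k \<Phi> arbitrary: c rule: placements.induct) (force split: if_splits)+

lemma length_placements: "c \<in> placements k \<Phi> \<Longrightarrow> length c = length \<Phi>"
  by (simp add: mem_placements_iff)

lemma placements_Cons_start:
  assumes "c \<in> placements k (B # \<Phi>)"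
  obtains c' where "c = k # c'"
  using assms by (cases c) (auto simp: mem_placements_iff)

section \<open>Recursion for \<open>col\<close> when a row is put on top\<close>

lemma sorted_list_of_set_insert_least:
  assumes "finite S" "\<And>y. y \<in> S \<Longrightarrow> k < (y::nat)"
  shows "sorted_list_of_set (insert k S) = k # sorted_list_of_set S"
proof -
  have "k \<notin> S" using assms(2) by blast
  then show ?thesis using assms
    by (simp add: insort_is_Cons less_imp_le)
qed

lemma column_Cons:
  assumes "length c = length \<Phi>"
  shows "\<Union>{(A # \<Phi>) ! i | i. i < length (A # \<Phi>) \<and> (x # c) ! i = j} =
    (if x = j then A else {}) \<union> \<Union>{\<Phi> ! i | i. i < length \<Phi> \<and> c ! i = j}"
proof (rule set_eqI)
  fix z
  have "z \<in> \<Union>{(A # \<Phi>) ! i | i. i < length (A # \<Phi>) \<and> (x # c) ! i = j} \<longleftrightarrow>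
      (\<exists>i<Suc (length \<Phi>). (x # c) ! i = j \<and> z \<in> (A # \<Phi>) ! i)" by auto
  also have "\<dots> \<longleftrightarrow> x = j \<and> z \<in> A \<or> (\<exists>i<length \<Phi>. c ! i = j \<and> z \<in> \<Phi> ! i)"
    by (simp add: Ex_less_Suc2)
  also have "\<dots> \<longleftrightarrow>
      z \<in> (if x = j then A else {}) \<union> \<Union>{\<Phi> ! i | i. i < length \<Phi> \<and> c ! i = j}" by auto
  finally show "z \<in> \<Union>{(A # \<Phi>) ! i | i. i < length (A # \<Phi>) \<and> (x # c) ! i = j} \<longleftrightarrow>
      z \<in> (if x = j then A else {}) \<union> \<Union>{\<Phi> ! i | i. i < length \<Phi> \<and> c ! i = j}" .
qed

text \<open>Column \<open>k\<close> lies to the left of all columns of \<open>c\<close>, so it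
  contains only \<open>A\<close> and comes first.\<close>

lemma col_Cons_new:
  assumes "length c = length \<Phi>" "\<And>y. y \<in> set c \<Longrightarrow> k < y"
  shows "col (A # \<Phi>) (k # c) = A # col \<Phi> c"
proof -
  have "\<Union>{\<Phi> ! i | i. i < length \<Phi> \<and> c ! i = k} = {}"
    using assms nth_mem[of _ c] by fastforce
  moreover have "k \<notin> set c" using assms(2) by blast
  ultimately show ?thesis
    using sorted_list_of_set_insert_least[of "set c" k] assms(2)
    unfolding col_def column_Cons[OF assms(1)] by auto
qed

text \<open>Column \<open>k\<close> is already the leftmost column of \<open>c\<close>, so the list
  of columns is unchanged and \<open>A\<close> is absorbed by its first entry.\<close>

lemma col_Cons_same:
  assumes "length c = length \<Phi>" "c = k # c'" "\<And>y. y \<in> set c \<Longrightarrow> k \<le> y"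
  shows "col (A # \<Phi>) (k # c) = (A \<union> hd (col \<Phi> c)) # tl (col \<Phi> c)"
proof -
  have "set c = insert k (set c - {k})" using assms(2) by auto
  moreover have "k < y" if "y \<in> set c - {k}" for y using that assms(3)[of y] by auto
  ultimately have s: "sorted_list_of_set (set c) = k # sorted_list_of_set (set c - {k})"
    using sorted_list_of_set_insert_least[of "set c - {k}" k] by auto
  have "set (k # c) = set c" using assms(2) by auto
  then show ?thesis
    unfolding col_def column_Cons[OF assms(1)] by (auto simp: s)
qed

text \<open>A set composition of an arbitrary ground set, so that inductions may remove the first
  block; what remains of \<open>{1..n}\<close> need not be an initial interval.\<close>

definition ordered_partition :: "'a set \<Rightarrow> 'a set list \<Rightarrow> bool" where
  "ordered_partition X \<Phi> \<longleftrightarrow> distinct \<Phi> \<and> partition_on X (set \<Phi>)"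

lemma ordered_partition_Cons:
  "ordered_partition X (A # \<Phi>) \<longleftrightarrow> A \<noteq> {} \<and> A \<subseteq> X \<and> ordered_partition (X - A) \<Phi>"
proof
  assume l: "ordered_partition X (A # \<Phi>)"
  then have "disjnt A (\<Union>(set \<Phi>))"
    by (auto simp: ordered_partition_def partition_on_def disjnt_def pairwise_insert)
  then show "A \<noteq> {} \<and> A \<subseteq> X \<and> ordered_partition (X - A) \<Phi>"
    using l partition_on_insert by (auto simp: ordered_partition_def)
next
  assume r: "A \<noteq> {} \<and> A \<subseteq> X \<and> ordered_partition (X - A) \<Phi>"
  then have u: "\<Union>(set \<Phi>) = X - A" by (auto simp: ordered_partition_def partition_on_def)
  then have "disjnt A (\<Union>(set \<Phi>))" "A \<notin> set \<Phi>" using r by (auto simp: disjnt_def)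
  then show "ordered_partition X (A # \<Phi>)"
    using r partition_on_insert by (auto simp: ordered_partition_def)
qed

lemma ordered_partition_Nil: "ordered_partition X [] \<longleftrightarrow> X = {}"
  by (auto simp: ordered_partition_def partition_on_def)

lemma ordered_partition_block_sizes:
  assumes "ordered_partition X \<Phi>" "finite X"
  shows "composition (block_sizes \<Phi>) \<and> sum_list (block_sizes \<Phi>) = card X"
  using assms
proof (induction \<Phi> arbitrary: X)
  case (Cons A \<Phi>)
  have A: "A \<noteq> {}" "A \<subseteq> X" "ordered_partition (X - A) \<Phi>" "finite A"
    using Cons.prems finite_subset by (auto simp: ordered_partition_Cons)
  then have "composition (block_sizes \<Phi>)" "sum_list (block_sizes \<Phi>) = card (X - A)"
    using Cons.IH[OF A(3)] Cons.prems(2) by auto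
  then show ?case using A Cons.prems(2) card_mono[of X A] card_gt_0_iff[of A]
    by (simp add: block_sizes_def composition_def card_Diff_subset)
qed (auto simp: block_sizes_def composition_def ordered_partition_Nil)

text \<open>The two alternatives in the recursion of \<open>placements\<close>: the next block
  starts in the column of \<open>A\<close> or further right. Nonemptiness makes \<open>hd\<close>
  and \<open>tl\<close> in the first alternative meaningful.\<close>

lemma col_placements:
  assumes "c \<in> placements k (B # \<Phi>)"
  shows "col (A # B # \<Phi>) (k # c) = (A \<union> hd (col (B # \<Phi>) c)) # tl (col (B # \<Phi>) c)"
    and "c \<in> placements k' (B # \<Phi>) \<Longrightarrow> j < k' \<Longrightarrow> col (A # B # \<Phi>) (j # c) = A # col (B # \<Phi>) c"
    and "col (B # \<Phi>) c \<noteq> []"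
proof -
  obtain c' where c': "c = k # c'" using placements_Cons_start[OF assms] .
  show "col (A # B # \<Phi>) (k # c) = (A \<union> hd (col (B # \<Phi>) c)) # tl (col (B # \<Phi>) c)"
    using col_Cons_same[OF length_placements[OF assms] c'] placements_lower_bound[OF assms] by blast
  show "col (B # \<Phi>) c \<noteq> []" by (simp add: col_def c')
  show "col (A # B # \<Phi>) (j # c) = A # col (B # \<Phi>) c" if "c \<in> placements k' (B # \<Phi>)" "j < k'"
    using col_Cons_new[OF length_placements[OF assms]] placements_lower_bound[OF that(1)] that(2)
    by (meson less_le_trans)
qed

text \<open>Merging \<open>A\<close> with the first column \<open>H\<close> is harmless because
  \<open>X - A - H = X - (A \<union> H)\<close>. The result makes every summand of
  \<open>ncP\<close> a basis element on which \<open>rho_proj\<close> is determined.\<close>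

lemma ordered_partition_col:
  assumes "c \<in> placements k \<Phi>" "ordered_partition X \<Phi>"
  shows "ordered_partition X (col \<Phi> c)"
  using assms
proof (induction k \<Phi> arbitrary: c X rule: placements.induct)
  case (3 k A B \<Phi>)
  have A: "A \<noteq> {}" "A \<subseteq> X" "ordered_partition (X - A) (B # \<Phi>)"
    using "3.prems"(2) by (simp_all add: ordered_partition_Cons[of X])
  consider t where "c = k # t" "t \<in> placements (Suc k) (B # \<Phi>)"
    | t where "c = k # t" "A >\<^sub>D B" "t \<in> placements k (B # \<Phi>)"
    using "3.prems"(1) by (auto split: if_splits)
  then show ?case
  proof cases
    case 1
    then show ?thesis
      using "3.IH"(1)[OF 1(2) A(3)] A col_placements(2)[OF 1(2) 1(2)]
      by (auto simp: ordered_partition_Cons)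
  next
    case 2
    have "ordered_partition (X - A) (col (B # \<Phi>) t)" using "3.IH"(2)[OF 2(2,3) A(3)] .
    moreover obtain H T where "col (B # \<Phi>) t = H # T"
      using col_placements(3)[OF 2(3)] by (auto simp: neq_Nil_conv)
    ultimately show ?thesis using A 2(1) col_placements(1)[OF 2(3)]
      by (simp add: ordered_partition_Cons Diff_eq Int_assoc)
  qed
qed (auto simp: col_def ordered_partition_Nil)


section \<open>Partial sums of the column unions\<close>

lemma sum_interval_image:
  assumes "inj h"
  shows "(\<Sum>S | h ` C \<subseteq> S \<and> S \<subseteq> h ` R. g S) = (\<Sum>S | C \<subseteq> S \<and> S \<subseteq> R. g (h ` S))"
proof -
  have "bij_betw ((`) h) {S. C \<subseteq> S \<and> S \<subseteq> R} {S. h ` C \<subseteq> S \<and> S \<subseteq> h ` R}"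
  proof (rule bij_betwI')
    fix S assume S: "S \<in> {S. h ` C \<subseteq> S \<and> S \<subseteq> h ` R}"
    then obtain T where "T \<subseteq> R" "S = h ` T" by (auto simp: subset_image_iff)
    moreover from this have "C \<subseteq> T" using S inj_image_subset_iff[OF assms, of C T] by simp
    ultimately show "\<exists>T\<in>{S. C \<subseteq> S \<and> S \<subseteq> R}. S = h ` T" by blast
  qed (use assms in \<open>auto simp: inj_image_eq_iff\<close>)
  from sum.reindex_bij_betw[OF this, of g] show ?thesis by simp
qed

lemma sum_interval_insert_both:
  assumes "a \<notin> R" "C \<subseteq> R"
  shows "(\<Sum>S | insert a C \<subseteq> S \<and> S \<subseteq> insert a R. g S) = (\<Sum>S | C \<subseteq> S \<and> S \<subseteq> R. g (insert a S))"
proof -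
  have "bij_betw (insert a) {S. C \<subseteq> S \<and> S \<subseteq> R} {S. insert a C \<subseteq> S \<and> S \<subseteq> insert a R}"
    by (rule bij_betw_byWitness[where f' = "\<lambda>S. S - {a}"]) (use assms in auto)
  from sum.reindex_bij_betw[OF this, of g] show ?thesis by simp
qed

text \<open>The sets are split by whether they contain \<open>a\<close>. In
  \<open>sum_placements\<close> the two sums belong to the placements that open a new column after
  the first block and to those that do not.\<close>

lemma sum_interval_insert:
  assumes "a \<notin> R" "C \<subseteq> R" "finite R"
  shows "(\<Sum>S | C \<subseteq> S \<and> S \<subseteq> insert a R. g S) =
    (\<Sum>S | C \<subseteq> S \<and> S \<subseteq> R. g (insert a S)) + (\<Sum>S | C \<subseteq> S \<and> S \<subseteq> R. g S)"
proof -
  have "{S. C \<subseteq> S \<and> S \<subseteq> insert a R} =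
      {S. insert a C \<subseteq> S \<and> S \<subseteq> insert a R} \<union> {S. C \<subseteq> S \<and> S \<subseteq> R}" by auto
  moreover have "finite {S. insert a C \<subseteq> S \<and> S \<subseteq> insert a R}" "finite {S. C \<subseteq> S \<and> S \<subseteq> R}"
    using assms(3) by auto
  moreover have "{S. insert a C \<subseteq> S \<and> S \<subseteq> insert a R} \<inter> {S. C \<subseteq> S \<and> S \<subseteq> R} = {}"
    using assms by auto
  ultimately show ?thesis
    using sum_interval_insert_both[OF assms(1,2), of g] by (simp only: sum.union_disjoint)
qed

text \<open>Every partial sum includes the first part, so enlarging that part shifts them
  all.\<close>

lemma partial_sums_add_hd:
  "xs \<noteq> [] \<Longrightarrow> partial_sums ((a + hd xs) # tl xs) = (+) a ` partial_sums xs"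
  by (cases xs) (auto simp: partial_sums_Cons image_image add.assoc)

text \<open>Disjoint nonempty sets have different minima, which decides ties in size. This
  reconciles \<open>segments\<close>, which tests \<open>B >\<^sub>D A\<close>, with
  \<open>placements\<close>, which tests \<open>A >\<^sub>D B\<close>.\<close>

lemma gtD_total:
  assumes "A \<noteq> {}" "B \<noteq> {}" "finite A" "finite B" "A \<inter> B = {}"
  shows "B >\<^sub>D A \<longleftrightarrow> \<not> A >\<^sub>D B"
proof -
  have "Min A \<noteq> Min B" using assms Min_in by (metis disjoint_iff)
  then show ?thesis by (auto simp: gtD_def)
qed

text \<open>The arbitrary weight \<open>g\<close> expresses that the placements run through the
  interval of sets, each set occurring once, and it may change during the induction. The first
  boundary \<open>a = card A\<close> is optional at a descent and forced otherwise; the remaining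
  boundaries are those of the tail, shifted by \<open>a\<close>.\<close>

lemma sum_placements:
  assumes "ordered_partition X \<Phi>" "finite X"
  shows "(\<Sum>c\<in>placements k \<Phi>. g (partial_sums (block_sizes (col \<Phi> c)))) =
    (\<Sum>S | partial_sums (rho_C \<Phi>) \<subseteq> S \<and> S \<subseteq> partial_sums (block_sizes \<Phi>). g S :: 'a::comm_monoid_add)"
  using assms
proof (induction k \<Phi> arbitrary: X g rule: placements.induct)
  case (1 k)
  then show ?case by (simp add: col_def block_sizes_def rho_C_def partial_sums_def)
next
  case (2 k A)
  then show ?case by (simp add: col_def block_sizes_def rho_C_def partial_sums_def)
next
  case (3 k A B \<Phi>)
  have A: "A \<noteq> {}" "A \<subseteq> X" "ordered_partition (X - A) (B # \<Phi>)" "finite A"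
    using "3.prems" by (auto simp: ordered_partition_Cons[of X] intro: finite_subset)
  have B: "B \<noteq> {}" "B \<subseteq> X - A" "finite B"
    using A(3) "3.prems"(2) by (auto simp: ordered_partition_Cons intro: finite_subset)
  have fin: "finite (X - A)" using "3.prems" by blast
  define a where "a = card A"
  let ?\<Psi> = "B # \<Phi>"
  define C R where "C = partial_sums (rho_C ?\<Psi>)" and "R = partial_sums (block_sizes ?\<Psi>)"
  let ?h = "(+) a"
  let ?f = "\<lambda>c. partial_sums (block_sizes (col ?\<Psi> c))"
  let ?f' = "\<lambda>c. partial_sums (block_sizes (col (A # ?\<Psi>) (k # c)))"
  note bs = ordered_partition_block_sizes[OF A(3) fin, THEN conjunct1]
    ordered_partition_block_sizes[OF A(3) fin, THEN conjunct2]
  have CR: "C \<subseteq> R"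
    unfolding C_def R_def using bs(1) comp_le_rho_C comp_le_composition comp_le_iff_partial_sums by blast
  have R0: "0 \<notin> R" unfolding R_def using partial_sums_pos[OF bs(1), of 0] by blast
  have finR: "finite R" by (simp add: R_def finite_partial_sums)
  have R': "partial_sums (block_sizes (A # ?\<Psi>)) = insert a (?h ` R)"
    by (simp add: block_sizes_def a_def R_def partial_sums_Cons)
  have seg: "segments ?\<Psi> \<noteq> []" using segments_nonempty(2) by blast
  have C': "partial_sums (rho_C (A # ?\<Psi>)) = (if A >\<^sub>D B then ?h ` C else insert a (?h ` C))"
  proof (cases "A >\<^sub>D B")
    case True
    then have "\<not> B >\<^sub>D A" using gtD_total[of A B] A B by blast
    then have "rho_C (A # ?\<Psi>) = (a + hd (rho_C ?\<Psi>)) # tl (rho_C ?\<Psi>)"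
      using seg by (simp add: rho_C_def a_def hd_map map_tl)
    then show ?thesis using True seg partial_sums_add_hd[of "rho_C ?\<Psi>" a]
      by (simp add: C_def rho_C_def)
  next
    case False
    then have "B >\<^sub>D A" using gtD_total[of A B] A B by blast
    then have "rho_C (A # ?\<Psi>) = a # rho_C ?\<Psi>" by (simp add: rho_C_def a_def)
    then show ?thesis using False seg by (simp add: C_def rho_C_def partial_sums_Cons)
  qed
  have f'_new: "?f' c = insert a (?h ` ?f c)" if c: "c \<in> placements (Suc k) ?\<Psi>" for c
    using col_placements(2)[OF c c, of k A] col_placements(3)[OF c]
    by (simp add: block_sizes_def a_def partial_sums_Cons)
  have f'_same: "?f' c = ?h ` ?f c" if c: "c \<in> placements k ?\<Psi>" for c
  proof -
    obtain H T where HT: "col ?\<Psi> c = H # T"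
      using col_placements(3)[OF c] by (auto simp: neq_Nil_conv)
    then have "H \<subseteq> X - A"
      using ordered_partition_col[OF c A(3)] by (simp add: ordered_partition_Cons)
    then have "card (A \<union> H) = a + card H"
      using A(4) fin by (auto simp: a_def intro!: card_Un_disjoint dest: finite_subset)
    then have "block_sizes (col (A # ?\<Psi>) (k # c)) =
        (a + hd (block_sizes (col ?\<Psi> c))) # tl (block_sizes (col ?\<Psi> c))"
      using col_placements(1)[OF c, of A] HT by (simp add: block_sizes_def)
    then show ?thesis using partial_sums_add_hd[of "block_sizes (col ?\<Psi> c)" a] HT
      by (simp add: block_sizes_def)
  qed
  \<comment> \<open>The induction hypothesis is used for \<open>g\<close> composed with the effect
    of \<open>A\<close> on the partial sums; \<open>sum_interval_image\<close> then absorbs the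
    shift.\<close>
  have new: "(\<Sum>c\<in>placements (Suc k) ?\<Psi>. g (?f' c)) =
      (\<Sum>S | ?h ` C \<subseteq> S \<and> S \<subseteq> ?h ` R. g (insert a S))"
    using "3.IH"(1)[OF A(3) fin, of "\<lambda>S. g (insert a (?h ` S))"]
    by (simp add: f'_new sum_interval_image C_def R_def cong: sum.cong)
  have same: "(\<Sum>c\<in>placements k ?\<Psi>. g (?f' c)) =
      (\<Sum>S | ?h ` C \<subseteq> S \<and> S \<subseteq> ?h ` R. g S)" if "A >\<^sub>D B"
    using "3.IH"(2)[OF that A(3) fin, of "\<lambda>S. g (?h ` S)"]
    by (simp add: f'_same sum_interval_image C_def R_def cong: sum.cong)
  have a: "a \<notin> ?h ` R" "?h ` C \<subseteq> ?h ` R" "finite (?h ` R)" using R0 CR finR by auto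
  \<comment> \<open>The two kinds of placements differ in the column of \<open>B\<close>.\<close>
  have disj: "placements (Suc k) ?\<Psi> \<inter> placements k ?\<Psi> = {}"
    by (auto simp: mem_placements_iff)
  show ?case
  proof (cases "A >\<^sub>D B")
    case True
    have "(\<Sum>c\<in>placements k (A # ?\<Psi>). g (partial_sums (block_sizes (col (A # ?\<Psi>) c)))) =
        (\<Sum>c\<in>placements (Suc k) ?\<Psi>. g (?f' c)) + (\<Sum>c\<in>placements k ?\<Psi>. g (?f' c))"
      using True sum.union_disjoint[OF finite_placements finite_placements disj]
      by (simp add: sum.reindex)
    then show ?thesis
      unfolding new same[OF True] R' C' using True sum_interval_insert[OF a, of g] by simp
  next
    case False
    then show ?thesis
      unfolding R' C' using new sum_interval_insert_both[OF a(1,2), of g] by (simp add: sum.reindex)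
  qed
qed


section \<open>The expansion of the projected power sums\<close>

text \<open>\<open>N\<close> stands for \<open>qM\<close> read as a function of the set of partial
  sums; refinements of \<open>\<beta>\<close> are then the supersets of its set.\<close>

lemma qF_partial_sums:
  assumes "composition \<beta>" "sum_list \<beta> = m"
    "\<And>\<alpha>. composition \<alpha> \<Longrightarrow> sum_list \<alpha> = m \<Longrightarrow> N (partial_sums \<alpha>) = qM \<alpha>"
  shows "qF \<beta> = (\<Sum>S | partial_sums \<beta> \<subseteq> S \<and> S \<subseteq> {1..<m}. N S)"
proof -
  let ?I = "{\<alpha>. composition \<alpha> \<and> comp_le \<alpha> \<beta>}"
  have mem: "\<alpha> \<in> ?I \<longleftrightarrow> composition \<alpha> \<and> sum_list \<alpha> = m \<and> partial_sums \<beta> \<subseteq> partial_sums \<alpha>" for \<alpha>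
    using comp_le_iff_partial_sums[of \<alpha> \<beta>] assms by auto
  have "bij_betw partial_sums ?I {S. partial_sums \<beta> \<subseteq> S \<and> S \<subseteq> {1..<m}}"
  proof (rule bij_betw_subset[OF bij_betw_partial_sums[of m]])
    show "partial_sums ` ?I = {S. partial_sums \<beta> \<subseteq> S \<and> S \<subseteq> {1..<m}}"
    proof (intro set_eqI iffI)
      fix S assume S: "S \<in> {S. partial_sums \<beta> \<subseteq> S \<and> S \<subseteq> {1..<m}}"
      then obtain \<alpha> where "composition \<alpha>" "sum_list \<alpha> = m" "partial_sums \<alpha> = S"
        using composition_with_partial_sums by blast
      then show "S \<in> partial_sums ` ?I" using S mem by blast
    next
      fix S assume "S \<in> partial_sums ` ?I"
      then obtain \<alpha> where \<alpha>: "\<alpha> \<in> ?I" "S = partial_sums \<alpha>" by blast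
      then show "S \<in> {S. partial_sums \<beta> \<subseteq> S \<and> S \<subseteq> {1..<m}}"
        using mem[of \<alpha>] partial_sums_subset[of \<alpha>] by simp
    qed
  qed (use mem in blast)
  from sum.reindex_bij_betw[OF this, of N]
  have "(\<Sum>S | partial_sums \<beta> \<subseteq> S \<and> S \<subseteq> {1..<m}. N S) = (\<Sum>\<alpha>\<in>?I. N (partial_sums \<alpha>))" by simp
  also have "\<dots> = qF \<beta>"
    unfolding qF_def by (rule sum.cong) (use mem assms(3) in auto)
  finally show ?thesis by simp
qed

text \<open>
  Exchanging the sums, the coefficient of \<open>N B\<close> is the alternating sum over the interval from
  \<open>C\<close> to \<open>B \<inter> (C \<union> (U - R))\<close>, which vanishes unless this interval is trivial, that is, \<open>B \<subseteq> R\<close>.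
\<close>
lemma alternating_interval_inversion:
  fixes N :: "'b set \<Rightarrow> 'a::comm_ring_1"
  assumes "finite U" "C \<subseteq> R" "R \<subseteq> U"
  shows "(\<Sum>A | C \<subseteq> A \<and> A \<subseteq> C \<union> (U - R). (-1) ^ card (A - C) * (\<Sum>B | A \<subseteq> B \<and> B \<subseteq> U. N B)) =
    (\<Sum>B | C \<subseteq> B \<and> B \<subseteq> R. N B)"
proof -
  let ?I = "C \<union> (U - R)"
  have "{A. C \<subseteq> A \<and> A \<subseteq> ?I} \<subseteq> Pow U" using assms by auto
  then have fin: "finite {A. C \<subseteq> A \<and> A \<subseteq> ?I}" "finite {B. B \<subseteq> U}"
    using assms(1) by (auto intro: finite_subset)
  have "(\<Sum>A | C \<subseteq> A \<and> A \<subseteq> ?I. (-1) ^ card (A - C) * (\<Sum>B | A \<subseteq> B \<and> B \<subseteq> U. N B)) =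
      (\<Sum>A\<in>{A. C \<subseteq> A \<and> A \<subseteq> ?I}. \<Sum>B\<in>{B \<in> {B. B \<subseteq> U}. A \<subseteq> B}. (-1) ^ card (A - C) * N B)"
    by (intro sum.cong refl) (auto simp: sum_distrib_left intro!: sum.cong)
  also have "\<dots> = (\<Sum>B | B \<subseteq> U. \<Sum>A\<in>{A \<in> {A. C \<subseteq> A \<and> A \<subseteq> ?I}. A \<subseteq> B}. (-1) ^ card (A - C) * N B)"
    by (rule sum.swap_restrict[OF fin])
  also have "\<dots> = (\<Sum>B | B \<subseteq> U. if C \<subseteq> B \<and> B \<subseteq> R then N B else 0)"
  proof (rule sum.cong)
    fix B assume B: "B \<in> {B. B \<subseteq> U}"
    have eq: "{A \<in> {A. C \<subseteq> A \<and> A \<subseteq> ?I}. A \<subseteq> B} = {A. C \<subseteq> A \<and> A \<subseteq> ?I \<inter> B}" by auto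
    show "(\<Sum>A\<in>{A \<in> {A. C \<subseteq> A \<and> A \<subseteq> ?I}. A \<subseteq> B}. (-1) ^ card (A - C) * N B) =
        (if C \<subseteq> B \<and> B \<subseteq> R then N B else 0)"
    proof (cases "C \<subseteq> B")
      case True
      then have J: "C \<subseteq> ?I \<inter> B" "finite (?I \<inter> B)" "?I \<inter> B = C \<longleftrightarrow> B \<subseteq> R"
        using B assms finite_subset[of B U] by auto
      show ?thesis
        unfolding eq sum_distrib_right[symmetric] sum_interval_alternating(1)[OF J(2,1)]
        using True J(3) by simp
    next
      case False
      then have none: "{A. C \<subseteq> A \<and> A \<subseteq> ?I \<inter> B} = {}" by auto
      show ?thesis unfolding eq none using False by simp
    qed
  qed simp
  also have "\<dots> = (\<Sum>B | C \<subseteq> B \<and> B \<subseteq> R. N B)"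
    using fin(2) assms by (intro sum.mono_neutral_cong_right) auto
  finally show ?thesis .
qed

text \<open>Linearity reduces the claim to single terms, and each \<open>col \<Phi> c\<close> is
  again a set composition of \<open>n\<close>, so \<open>rho_proj_ncM\<close> evaluates its
  term.\<close>

lemma rho_proj_ncP:
  assumes "set_composition n \<Phi>"
  shows "(rho_proj (ncP \<Phi>) :: 'a::field cseries) = (\<Sum>c\<in>LDD \<Phi>. qM (block_sizes (col \<Phi> c)))"
proof -
  interpret Vector_Spaces.linear scl scl "rho_proj :: 'a ncseries \<Rightarrow> 'a cseries"
    by (rule linear_rho_proj)
  have "set_composition n (col \<Phi> c)" if "c \<in> LDD \<Phi>" for c
    using that assms ordered_partition_col[of c 1 \<Phi> "{1..n}"]
    by (simp add: LDD_eq_placements set_composition_def ordered_partition_def)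
  then show ?thesis
    unfolding ncP_def sum by (intro sum.cong refl) (use rho_proj_ncM in blast)
qed

theorem theorem4p9:
  fixes \<Phi> :: "nat set list" and n :: nat
  assumes "set_composition n \<Phi>"
  shows "(rho_proj (ncP \<Phi>) :: 'a::field cseries) =
           (\<Sum>\<alpha> | comp_le (rho_I \<Phi>) \<alpha> \<and> comp_le \<alpha> (rho_C \<Phi>).
              scl (of_int (moebius \<alpha> (rho_C \<Phi>))) (qF \<alpha>))
       \<and> (\<forall>\<alpha> \<beta>. composition \<alpha> \<and> composition \<beta> \<and> comp_le \<alpha> \<beta> \<longrightarrow>
              moebius \<alpha> \<beta> = (-1) ^ (length \<alpha> - length \<beta>))"
proof (intro conjI)
  have op: "ordered_partition {1..n} \<Phi>"
    using assms by (simp add: set_composition_def ordered_partition_def)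
  \<comment> \<open>Transfers \<open>qM\<close> to sets through the inverse of
    \<open>partial_sums\<close> on compositions of \<open>n\<close>. It is meaningful for subsets of
    \<open>{1..<n}\<close>, and only such sets occur below.\<close>
  define N :: "nat set \<Rightarrow> 'a cseries"
    where "N S = qM (the_inv_into {\<gamma>. composition \<gamma> \<and> sum_list \<gamma> = n} partial_sums S)" for S
  have N: "N (partial_sums \<gamma>) = qM \<gamma>" if "composition \<gamma>" "sum_list \<gamma> = n" for \<gamma>
    using that the_inv_into_f_f[OF bij_betw_imp_inj_on[OF bij_betw_partial_sums[of n]], of \<gamma>]
    by (simp add: N_def)
  define C R where "C = partial_sums (rho_C \<Phi>)" and "R = partial_sums (block_sizes \<Phi>)"
  have bs: "composition (block_sizes \<Phi>)" "sum_list (block_sizes \<Phi>) = n"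
    using ordered_partition_block_sizes[OF op] by simp_all
  have rC: "composition (rho_C \<Phi>)" "sum_list (rho_C \<Phi>) = n"
    using comp_le_composition comp_le_rho_C bs comp_le_sum_list by (blast, metis)
  have rI: "composition (rho_I \<Phi>)" "sum_list (rho_I \<Phi>) = n"
    using composition_rho_I sum_list_rho_I bs by auto
  have CR: "C \<subseteq> R" "R \<subseteq> {1..<n}"
    using comp_le_rho_C bs rC comp_le_iff_partial_sums partial_sums_subset
    unfolding C_def R_def by (blast, metis)
  have I: "partial_sums (rho_I \<Phi>) = C \<union> ({1..<n} - R)"
    using partial_sums_rho_I[OF bs(1)] bs(2) by (simp add: C_def R_def)
  let ?J = "{\<alpha>. comp_le (rho_I \<Phi>) \<alpha> \<and> comp_le \<alpha> (rho_C \<Phi>)}"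
  have "(rho_proj (ncP \<Phi>) :: 'a cseries) =
      (\<Sum>c\<in>LDD \<Phi>. N (partial_sums (block_sizes (col \<Phi> c))))"
    unfolding rho_proj_ncP[OF assms]
  proof (intro sum.cong refl)
    fix c assume "c \<in> LDD \<Phi>"
    then have "ordered_partition {1..n} (col \<Phi> c)"
      using ordered_partition_col op LDD_eq_placements by blast
    from ordered_partition_block_sizes[OF this finite_atLeastAtMost]
    show "qM (block_sizes (col \<Phi> c)) = N (partial_sums (block_sizes (col \<Phi> c)))"
      using N by simp
  qed
  also have "\<dots> = (\<Sum>B | C \<subseteq> B \<and> B \<subseteq> R. N B)"
    unfolding LDD_eq_placements C_def R_def by (rule sum_placements[OF op finite_atLeastAtMost])
  also have "\<dots> = (\<Sum>A | C \<subseteq> A \<and> A \<subseteq> C \<union> ({1..<n} - R).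
      scl ((-1) ^ card (A - C)) (\<Sum>B | A \<subseteq> B \<and> B \<subseteq> {1..<n}. N B))"
  proof
    \<comment> \<open>Taking the coefficient of a monomial turns \<open>scl\<close> into
      multiplication in the field, where the inversion applies.\<close>
    fix m
    show "(\<Sum>B | C \<subseteq> B \<and> B \<subseteq> R. N B) m = (\<Sum>A | C \<subseteq> A \<and> A \<subseteq> C \<union> ({1..<n} - R).
      scl ((-1) ^ card (A - C)) (\<Sum>B | A \<subseteq> B \<and> B \<subseteq> {1..<n}. N B)) m"
      using alternating_interval_inversion[OF _ CR, of "\<lambda>B. N B m"]
      by (simp add: sum_fun_apply scl_def)
  qed
  \<comment> \<open>By \<open>I\<close>, the two ends of the interval of sets are the sets of
    \<open>rho_C \<Phi>\<close> and \<open>rho_I \<Phi>\<close>, so the sum can be reindexed by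
    compositions.\<close>
  also have "\<dots> = (\<Sum>\<alpha>\<in>?J. scl ((-1) ^ card (partial_sums \<alpha> - C))
      (\<Sum>B | partial_sums \<alpha> \<subseteq> B \<and> B \<subseteq> {1..<n}. N B))"
    using sum.reindex_bij_betw[OF bij_betw_partial_sums_interval[OF rI(1) rC(1)],
        of "\<lambda>A. scl ((-1) ^ card (A - C)) (\<Sum>B | A \<subseteq> B \<and> B \<subseteq> {1..<n}. N B)"]
    by (simp add: rC(2) rI(2) I C_def[symmetric])
  also have "\<dots> = (\<Sum>\<alpha>\<in>?J. scl (of_int (moebius \<alpha> (rho_C \<Phi>))) (qF \<alpha>))"
  proof (intro sum.cong refl)
    fix \<alpha> assume "\<alpha> \<in> ?J"
    then have \<alpha>: "composition \<alpha>" "sum_list \<alpha> = n" "comp_le \<alpha> (rho_C \<Phi>)"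
      using comp_le_composition rI rC(2) comp_le_sum_list by (blast, force, blast)
    show "scl ((-1) ^ card (partial_sums \<alpha> - C)) (\<Sum>B | partial_sums \<alpha> \<subseteq> B \<and> B \<subseteq> {1..<n}. N B) =
        scl (of_int (moebius \<alpha> (rho_C \<Phi>))) (qF \<alpha>)"
      using qF_partial_sums[OF \<alpha>(1,2), of N, OF N]
      by (simp add: C_def moebius_partial_sums[OF \<alpha>(1) rC(1) \<alpha>(3)])
  qed
  finally show "(rho_proj (ncP \<Phi>) :: 'a cseries) =
      (\<Sum>\<alpha> | comp_le (rho_I \<Phi>) \<alpha> \<and> comp_le \<alpha> (rho_C \<Phi>).
         scl (of_int (moebius \<alpha> (rho_C \<Phi>))) (qF \<alpha>))" .
qed (use moebius_composition in blast)

end
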